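(* Suppose $d,k,n$ are positive integers with $d+1\ge k\ge 2$. Then \[\chi^k_d(P_n)=\left\lceil\frac{\min(d+1,n)}{k-1}\right\rceil .\] Furthermore, \[\chi^k_d(P_\infty)=\left\lceil\frac{d+1}{k-1}\right\rceil .\]
   Context: $P_n$ is the path graph on $n$ vertices $\{1,\dots,n\}$ (consecutive integers adjacent), and $P_\infty$ is the two-way infinite path with vertex set $\mathbb Z$ (consecutive integers adjacent). A shortest path in a graph $G$ is a path between some vertices $u,v$ whose length (number of edges) equals the graph distance between $u$ and $v$. A set $S\subseteq V(G)$ is $k,d$-independent in $G$ if every shortest path in $G$ of length at most $d$ contains fewer than $k$ vertices of $S$. The $k,d$-chromatic number $\chi^k_d(G)$ is the least positive integer $c$ such that some coloring $V(G)\to\{1,\dots,c\}$ has all color classes $k,d$-independent. *)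

theory Defs
  imports "Graph_Theory.Graph_Theory" "HOL-Library.Extended_Nat"
begin

text \<open>
  Simple undirected graphs are symmetric loop-free digraphs without parallel arcs, as usual in
  \<^theory>\<open>Graph_Theory.Pair_Digraph\<close>: the edge $uv$ is the pair of arcs $(u,v)$, $(v,u)$.
\<close>

definition path_graph :: "nat \<Rightarrow> nat pair_pre_digraph" where
  "path_graph n =
     \<lparr> pverts = {1..n},
       parcs = {(i, j). i \<in> {1..n} \<and> j \<in> {1..n} \<and> (j = i + 1 \<or> i = j + 1)} \<rparr>"

definition infinite_path_graph :: "int pair_pre_digraph" where
  "infinite_path_graph = \<lparr> pverts = UNIV, parcs = {(i, j). j = i + 1 \<or> i = j + 1} \<rparr>"

lemma pair_graph_path_graph: "pair_graph (path_graph n)"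
proof -
  have "{(i, j). i \<in> {1..n} \<and> j \<in> {1..n} \<and> (j = i + 1 \<or> i = j + 1)} \<subseteq> {1..n} \<times> {1..n}"
    by auto
  then have "finite {(i, j). i \<in> {1..n} \<and> j \<in> {1..n} \<and> (j = i + 1 \<or> i = j + 1)}"
    by (rule finite_subset) simp
  then show ?thesis
    by unfold_locales (auto simp: path_graph_def symmetric_def intro!: symI)
qed

lemma pair_bidirected_digraph_infinite_path_graph:
  "pair_bidirected_digraph infinite_path_graph"
  by unfold_locales (auto simp: infinite_path_graph_def symmetric_def intro!: symI)

text \<open>
  With all arc weights equal to 1, \<^term>\<open>wf_digraph.\<mu> G (\<lambda>_. 1) u v\<close> is the graph distance,
  the least number of arcs of a walk from \<^term>\<open>u\<close> to \<^term>\<open>v\<close> (infinite if there is none).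
  A path is given by its start vertex and its list of arcs, so its length is the length of that
  list.
\<close>

definition shortest_path :: "('a, 'b) pre_digraph \<Rightarrow> 'a \<Rightarrow> 'b awalk \<Rightarrow> 'a \<Rightarrow> bool" where
  "shortest_path G u p v \<longleftrightarrow>
     pre_digraph.apath G u p v \<and> ereal (real (length p)) = wf_digraph.\<mu> G (\<lambda>_. 1) u v"

definition kd_independent :: "nat \<Rightarrow> nat \<Rightarrow> ('a, 'b) pre_digraph \<Rightarrow> 'a set \<Rightarrow> bool" where
  "kd_independent k d G S \<longleftrightarrow>
     S \<subseteq> verts G \<and>
     (\<forall>u p v. shortest_path G u p v \<and> length p \<le> d \<longrightarrow>
        card (set (pre_digraph.awalk_verts G u p) \<inter> S) < k)"

definition kd_coloring ::
  "nat \<Rightarrow> nat \<Rightarrow> ('a, 'b) pre_digraph \<Rightarrow> nat \<Rightarrow> ('a \<Rightarrow> nat) \<Rightarrow> bool" where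
  "kd_coloring k d G c f \<longleftrightarrow>
     f ` verts G \<subseteq> {1..c} \<and>
     (\<forall>i\<in>{1..c}. kd_independent k d G {v \<in> verts G. f v = i})"

text \<open>
  The infimum is taken in \<^typ>\<open>enat\<close>: it is attained whenever some finite number of colors
  suffices, and is \<^term>\<open>\<infinity> :: enat\<close> otherwise.
\<close>

definition kd_chromatic_number :: "nat \<Rightarrow> nat \<Rightarrow> ('a, 'b) pre_digraph \<Rightarrow> enat" where
  "kd_chromatic_number k d G = Inf {enat c | c. c > 0 \<and> (\<exists>f. kd_coloring k d G c f)}"

end

theory Submission
  imports Defs
begin

text \<open>
  Identify the vertices with an interval of integers. The vertices of a path with at most $d$
  arcs lie in a window of $m$ consecutive integers, where $m$ is $\min(d+1,n)$ or
  $d+1$. If $m \le c(k-1)$, giving runs of $k-1$ consecutive vertices the same color and repeating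
  the $c$ colors periodically works: a window contains each residue modulo $c(k-1)$ at most once.
  Conversely, $m$ consecutive vertices form a shortest path of length $m - 1 \le d$, on which
  every color occurs at most $k-1$ times, so $m \le c(k-1)$.
\<close>

text \<open>Common setting for both graphs: \<open>h\<close> places the vertices on the integer
  line. \<open>arc_step\<close> bounds how far a walk can spread, while \<open>succ_arc\<close>
  supplies walks through consecutive integers.\<close>

locale linear_digraph = wf_digraph G for G :: "('a, 'b) pre_digraph" +
  fixes h :: "'a \<Rightarrow> int"
  assumes inj_h: "inj_on h (verts G)"
    and arc_step: "e \<in> arcs G \<Longrightarrow> \<bar>h (tail G e) - h (head G e)\<bar> \<le> 1"
    and succ_arc: "\<lbrakk>u \<in> verts G; v \<in> verts G; h v = h u + 1\<rbrakk>
      \<Longrightarrow> \<exists>e\<in>arcs G. tail G e = u \<and> head G e = v"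
begin

text \<open>Each arc moves \<open>h\<close> by at most 1. Arbitrary vertices of the walk are
  compared, not just its ends, because two vertices of equal color may sit anywhere on it.\<close>

lemma awalk_verts_diameter:
  assumes "awalk u p v" "x \<in> set (awalk_verts u p)" "y \<in> set (awalk_verts u p)"
  shows "\<bar>h x - h y\<bar> \<le> int (length p)"
  using assms
proof (induction p arbitrary: u x y)
  case Nil
  then show ?case by simp
next
  case (Cons e p)
  let ?w = "head G e"
  have walk: "awalk ?w p v" and e: "e \<in> arcs G" "u = tail G e"
    using Cons.prems(1) by (auto simp: awalk_Cons_iff)
  note IH = Cons.IH[OF walk]
  \<comment> \<open>\<open>?w\<close> lies on the remaining walk, so the induction hypothesis
    compares it with \<open>z\<close>; the first arc adds at most 1.\<close>
  have far: "\<bar>h u - h z\<bar> \<le> 1 + int (length p)" if "z \<in> set (awalk_verts ?w p)" for z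
    using IH[OF hd_in_awalk_verts(1)[OF walk] that] arc_step[OF e(1)]
    unfolding e(2) by linarith
  from Cons.prems(2,3) e(2) consider "x = u" "y = u"
    | "x = u" "y \<in> set (awalk_verts ?w p)" | "y = u" "x \<in> set (awalk_verts ?w p)"
    | "x \<in> set (awalk_verts ?w p)" "y \<in> set (awalk_verts ?w p)"
    by auto
  then show ?case
    using far[of x] far[of y] IH[of x y] by cases auto
qed

lemma awalk_length_ge:
  assumes "awalk u p v"
  shows "\<bar>h u - h v\<bar> \<le> int (length p)"
proof (rule awalk_verts_diameter[OF assms])
  show "u \<in> set (awalk_verts u p)" using assms by (rule hd_in_awalk_verts)
  show "v \<in> set (awalk_verts u p)"
    using assms last_in_set[OF awalk_verts_non_Nil, of u p] by auto
qed

lemma ascending_awalk: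
  assumes "{a..a + int l} \<subseteq> h ` verts G"
  shows "\<exists>u p v. awalk u p v \<and> length p = l \<and> h u = a \<and> h v = a + int l \<and>
           h ` set (awalk_verts u p) = {a..a + int l}"
  using assms
proof (induction l arbitrary: a)
  case 0
  then obtain u where "u \<in> verts G" "h u = a" by auto
  then have "awalk u [] u" by (simp add: awalk_Nil_iff)
  then show ?case using \<open>h u = a\<close> by (intro exI[of _ u] exI[of _ "[]"]) simp
next
  case (Suc l)
  have "{a + 1..a + 1 + int l} \<subseteq> h ` verts G" using Suc.prems by auto
  from Suc.IH[OF this] obtain w p v where
    p: "awalk w p v" "length p = l" "h w = a + 1" "h v = a + 1 + int l"
      "h ` set (awalk_verts w p) = {a + 1..a + 1 + int l}"
    by blast
  have "a \<in> h ` verts G" using Suc.prems by auto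
  then obtain u where u: "u \<in> verts G" "h u = a" by auto
  have "w \<in> verts G" using p(1) by (rule awalk_hd_in_verts)
  then obtain e where e: "e \<in> arcs G" "tail G e = u" "head G e = w"
    using succ_arc[OF u(1)] u(2) p(3) by auto
  have "awalk u (e # p) v" using e p(1) by (simp add: awalk_Cons_iff)
  moreover have "h ` set (awalk_verts u (e # p)) = {a..a + int (Suc l)}"
    using e u(2) p(5) by auto
  ultimately show ?case using p(2,4) u(2)
    by (intro exI[of _ u] exI[of _ "e # p"] exI[of _ v]) auto
qed

text \<open>On the ascending walk \<open>h\<close> takes \<open>l + 1\<close> distinct values, so no
  vertex repeats; its ends differ by \<open>l\<close> under \<open>h\<close>, so no walk between
  them is shorter.\<close>

lemma ascending_shortest_path:
  assumes "{a..a + int l} \<subseteq> h ` verts G"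
  obtains u p v where "shortest_path G u p v" "length p = l" "card (set (awalk_verts u p)) = Suc l"
    "set (awalk_verts u p) \<subseteq> verts G"
proof -
  obtain u p v where p: "awalk u p v" "length p = l" "h u = a" "h v = a + int l"
    "h ` set (awalk_verts u p) = {a..a + int l}"
    using ascending_awalk[OF assms] by blast
  have sub: "set (awalk_verts u p) \<subseteq> verts G" using p(1) by auto
  have "card (set (awalk_verts u p)) = card (h ` set (awalk_verts u p))"
    by (rule card_image[symmetric]) (rule inj_on_subset[OF inj_h sub])
  then have card: "card (set (awalk_verts u p)) = Suc l" using p(5) by simp
  \<comment> \<open>The vertex list of a walk has one entry more than the walk has arcs, here as
    many as there are different vertices.\<close>
  then have "distinct (awalk_verts u p)"
    using p(2) by (intro card_distinct) (simp add: length_awalk_verts)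
  then have "apath u p v" using p(1) by (simp add: apath_def)
  moreover have cost: "awalk_cost (\<lambda>_. 1) q = real (length q)" for q :: "'b list"
    by (induction q) (auto simp: awalk_cost_def)
  have "\<mu> (\<lambda>_. 1) u v = ereal (real (length p))"
  proof (rule antisym)
    show "\<mu> (\<lambda>_. 1) u v \<le> ereal (real (length p))"
      using min_cost_le_walk_cost[OF p(1), of "\<lambda>_. 1"] by (simp add: cost)
    show "ereal (real (length p)) \<le> \<mu> (\<lambda>_. 1) u v"
      unfolding \<mu>_def
    proof (rule INF_greatest)
      \<comment> \<open>\<open>\<mu>\<close> is an infimum over all walks, so the bound must cover
        walks that repeat vertices.\<close>
      fix q assume "q \<in> {q. awalk u q v}"
      then have "\<bar>h u - h v\<bar> \<le> int (length q)" by (simp add: awalk_length_ge)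
      then have "length p \<le> length q" using p(2-4) by simp
      then show "ereal (real (length p)) \<le> ereal (awalk_cost (\<lambda>_. 1) q)"
        by (simp add: cost)
    qed
  qed
  ultimately have "shortest_path G u p v" by (simp add: shortest_path_def)
  then show thesis using that p(2) card sub by blast
qed

lemma kd_coloring_imp_le:
  assumes col: "kd_coloring k d G c f" and m: "0 < m" "m \<le> d + 1"
    and interval: "{a..<a + int m} \<subseteq> h ` verts G"
  shows "m \<le> c * (k - 1)"
proof -
  \<comment> \<open>A path on \<open>m\<close> vertices has \<open>l = m - 1\<close> arcs, so
    \<open>m \<le> d + 1\<close> says precisely that its length is at most \<open>d\<close>.\<close>
  obtain l where l: "m = Suc l" using m(1) gr0_implies_Suc by blast
  have "{a..a + int l} \<subseteq> h ` verts G" using interval l by auto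
  from ascending_shortest_path[OF this] obtain u p v where
    p: "shortest_path G u p v" "length p = l" "card (set (awalk_verts u p)) = Suc l"
      "set (awalk_verts u p) \<subseteq> verts G" .
  let ?P = "set (awalk_verts u p)"
  have few: "card (?P \<inter> {x \<in> verts G. f x = i}) \<le> k - 1" if "i \<in> {1..c}" for i
  proof -
    have "card (?P \<inter> {x \<in> verts G. f x = i}) < k"
      using col that p(1,2) m(2) l unfolding kd_coloring_def kd_independent_def
      by (metis Suc_eq_plus1 Suc_le_mono)
    then show ?thesis by simp
  qed
  have "?P \<subseteq> (\<Union>i\<in>{1..c}. ?P \<inter> {x \<in> verts G. f x = i})"
    using col p(4) unfolding kd_coloring_def by blast
  then have "card ?P \<le> card (\<Union>i\<in>{1..c}. ?P \<inter> {x \<in> verts G. f x = i})"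
    by (intro card_mono) auto
  also have "\<dots> \<le> (\<Sum>i\<in>{1..c}. card (?P \<inter> {x \<in> verts G. f x = i}))"
    by (rule card_UN_le) simp
  also have "\<dots> \<le> (\<Sum>i\<in>{1..c}. k - 1)" by (rule sum_mono) (rule few)
  finally show ?thesis using p(3) l by simp
qed

text \<open>The color is the index of the block of \<open>k - 1\<close> residues containing
  \<open>h x\<close> modulo the period \<open>c * (k - 1)\<close>, shifted to start at 1.
  \<open>diam\<close> says that vertices at most \<open>d\<close> apart fit in a window of
  \<open>m\<close> integers, whether \<open>d\<close> or the size of the graph is the limit.\<close>

lemma block_kd_coloring:
  assumes k: "k \<ge> 2" and m: "0 < m" "m \<le> c * (k - 1)"
    and diam: "\<And>u v. \<lbrakk>u \<in> verts G; v \<in> verts G; \<bar>h u - h v\<bar> \<le> int d\<rbrakk> \<Longrightarrow> \<bar>h u - h v\<bar> < int m"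
  shows "kd_coloring k d G c (\<lambda>x. nat (h x mod int (c * (k - 1)) div int (k - 1)) + 1)"
proof -
  define q where "q = int (k - 1)"
  define N where "N = int (c * (k - 1))"
  have q: "q > 0" using k by (simp add: q_def)
  have N: "N = int c * q" by (simp add: N_def q_def)
  have m_le: "int m \<le> N" using m(2) unfolding N_def by (simp only: of_nat_le_iff)
  then have N_pos: "N > 0" using m(1) by linarith
  define f where "f = (\<lambda>x. nat (h x mod N div q) + 1)"
  have div_ge: "h x mod N div q \<ge> 0" for x
    using N_pos q by (simp add: pos_imp_zdiv_nonneg_iff)
  have div_less: "h x mod N div q < int c" for x
  proof -
    have "h x mod N div q * q \<le> h x mod N"
      using div_mult_mod_eq[of "h x mod N" q] pos_mod_sign[OF q, of "h x mod N"] by linarith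
    also have "\<dots> < int c * q" using pos_mod_bound[OF N_pos, of "h x"] N by simp
    finally show ?thesis using q by simp
  qed
  have range: "f x \<in> {1..c}" for x
    using div_less[of x] div_ge[of x] by (simp add: f_def)
  \<comment> \<open>The bound is shown for every walk of length at most \<open>d\<close>: one color
    class on it injects, by residues modulo \<open>N\<close>, into a single block of
    \<open>q = k - 1\<close> integers.\<close>
  have indep: "card (set (awalk_verts u p) \<inter> {x \<in> verts G. f x = i}) < k"
    if p: "awalk u p v" "length p \<le> d" for u p v i
  proof -
    let ?A = "set (awalk_verts u p) \<inter> {x \<in> verts G. f x = i}"
    have "inj_on (\<lambda>x. h x mod N) ?A"
    proof (rule inj_onI)
      fix x y assume x: "x \<in> ?A" and y: "y \<in> ?A" and "h x mod N = h y mod N"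
      then have "N dvd h x - h y" by (simp add: mod_eq_dvd_iff)
      moreover have "\<bar>h x - h y\<bar> \<le> int d"
        using awalk_verts_diameter[OF p(1), of x y] p(2) x y by simp
      then have "\<bar>h x - h y\<bar> < N" using diam[of x y] x y m_le by fastforce
      \<comment> \<open>A nonzero multiple of \<open>N\<close> has absolute value at least
        \<open>N\<close>.\<close>
      ultimately have "h x = h y" using zdvd_not_zless[of "\<bar>h x - h y\<bar>" N] by fastforce
      then show "x = y" using inj_h x y by (auto dest: inj_onD)
    qed
    moreover have "(\<lambda>x. h x mod N) ` ?A \<subseteq> {(int i - 1) * q..<(int i - 1) * q + q}"
    proof
      fix r assume "r \<in> (\<lambda>x. h x mod N) ` ?A"
      then obtain x where x: "f x = i" "r = h x mod N" by auto
      \<comment> \<open>Nonnegativity ensures that \<open>nat\<close> in the color loses nothing;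
        the shift by 1 makes color \<open>i\<close> the block of index \<open>i - 1\<close>.\<close>
      then have "r div q = int i - 1" using div_ge[of x] by (auto simp: f_def)
      then have "r = (int i - 1) * q + r mod q" using div_mult_mod_eq[of r q] by simp
      then show "r \<in> {(int i - 1) * q..<(int i - 1) * q + q}"
        using pos_mod_bound[OF q, of r] pos_mod_sign[OF q, of r] by auto
    qed
    ultimately have "card ?A \<le> card {(int i - 1) * q..<(int i - 1) * q + q}"
      by (rule card_inj_on_le) simp
    then show ?thesis using k by (simp add: q_def)
  qed
  have "kd_coloring k d G c f"
    unfolding kd_coloring_def kd_independent_def
    using range indep by (auto simp: shortest_path_def dest: awalkI_apath)
  then show ?thesis by (simp add: f_def N_def q_def)
qed

lemma kd_chromatic_number_eq:
  assumes k: "k \<ge> 2" and m: "0 < m" "m \<le> d + 1"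
    and interval: "{a..<a + int m} \<subseteq> h ` verts G"
    and diam: "\<And>u v. \<lbrakk>u \<in> verts G; v \<in> verts G; \<bar>h u - h v\<bar> \<le> int d\<rbrakk> \<Longrightarrow> \<bar>h u - h v\<bar> < int m"
  shows "kd_chromatic_number k d G = enat (nat \<lceil>real m / (real k - 1)\<rceil>)"
proof -
  let ?c = "nat \<lceil>real m / (real k - 1)\<rceil>"
  \<comment> \<open>\<open>?c\<close> is thus the least number of colors satisfying the counting
    bound; taking \<open>c = ?c\<close> shows that the block coloring exists with \<open>?c\<close>
    colors.\<close>
  have ceil_le: "?c \<le> c \<longleftrightarrow> m \<le> c * (k - 1)" for c
  proof -
    have "?c \<le> c \<longleftrightarrow> real m / (real k - 1) \<le> real c"
      by (simp add: nat_le_iff ceiling_le_iff)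
    also have "\<dots> \<longleftrightarrow> real m \<le> real (c * (k - 1))"
      using k by (simp add: divide_le_eq of_nat_diff)
    finally show ?thesis by (simp only: of_nat_le_iff)
  qed
  have m_le: "m \<le> ?c * (k - 1)" using ceil_le by blast
  have "?c > 0" using m_le m(1) by (intro gr0I) simp
  show ?thesis
    unfolding kd_chromatic_number_def
  proof (intro antisym Inf_lower Inf_greatest)
    show "enat ?c \<in> {enat c |c. c > 0 \<and> (\<exists>f. kd_coloring k d G c f)}"
      using block_kd_coloring[OF k m(1) m_le diam] \<open>?c > 0\<close> by blast
  next
    fix x assume "x \<in> {enat c |c. c > 0 \<and> (\<exists>f. kd_coloring k d G c f)}"
    then obtain c f where "x = enat c" "kd_coloring k d G c f" by blast
    then show "enat ?c \<le> x"
      using kd_coloring_imp_le[OF _ m interval] ceil_le by simp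
  qed
qed

end

theorem theorem4p4:
  fixes d k n :: nat
  assumes "d > 0" "k > 0" "n > 0"
    and "d + 1 \<ge> k" "k \<ge> 2"
  shows "kd_chromatic_number k d (with_proj (path_graph n)) =
           enat (nat \<lceil>real (min (d + 1) n) / (real k - 1)\<rceil>) \<and>
         kd_chromatic_number k d (with_proj infinite_path_graph) =
           enat (nat \<lceil>real (d + 1) / (real k - 1)\<rceil>)"
proof
  interpret P: linear_digraph "with_proj (path_graph n)" int
    by unfold_locales (auto simp: path_graph_def)
  \<comment> \<open>The first \<open>min (d + 1) n\<close> vertices serve as the window for the
    lower bound.\<close>
  have "{1..<1 + int (min (d + 1) n)} \<subseteq> int ` {1..n}"
    by (auto simp: image_int_atLeastAtMost)
  then show "kd_chromatic_number k d (with_proj (path_graph n)) =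
      enat (nat \<lceil>real (min (d + 1) n) / (real k - 1)\<rceil>)"
    using assms by (intro P.kd_chromatic_number_eq) (auto simp: path_graph_def)
next
  interpret Z: linear_digraph "with_proj infinite_path_graph" id
    by unfold_locales (auto simp: infinite_path_graph_def)
  show "kd_chromatic_number k d (with_proj infinite_path_graph) =
      enat (nat \<lceil>real (d + 1) / (real k - 1)\<rceil>)"
    \<comment> \<open>Here \<open>h\<close> is onto the integers, so a window of
      \<open>d + 1\<close> vertices may start anywhere.\<close>
    using assms by (intro Z.kd_chromatic_number_eq) (auto simp: infinite_path_graph_def)
qed

end
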